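(* For every integer $m\ge 1$, there exist two distinct unknotting sequences of twisted knots $$K_m,K_{m-1},\dots,K_1,K_0\qquad\text{and}\qquad K'_m,K'_{m-1},\dots,K'_1,K'_0$$ such that $K_0$ is the trivial twisted knot without a bar and $K'_0$ is the trivial twisted knot with a bar. Further, the arc shift numbers satisfy $A(K_n)=n$ and $A(K'_n)=n$ for all $1\le n\le m$.
   Context: **Twisted knots.** A twisted knot diagram is a generic closed oriented curve in $\mathbb{R}^2$ whose double points are each marked either as a classical crossing (with over/under information, hence a sign $\pm1$) or as a virtual crossing, and which carries finitely many bars (short transverse marks) placed on the curve away from the double points. Its Gauss diagram is an oriented circle parametrizing the curve, with one chord for each classical crossing joining its two preimages, directed from the over endpoint to the under endpoint and labelled with the sign, and with the bars recorded as marked points on the circle; virtual crossings are not recorded. Two diagrams are equivalent if they are related by planar isotopy and the extended Reidemeister moves: the classical moves $R_1,R_2,R_3$; the virtual moves $V_1,V_2,V_3,V_4$ (the Reidemeister moves with all crossings virtual, and the move passing a strand with only virtual crossings across a classical crossing); $T_1$ (a bar slides along its strand through a virtual crossing); $T_2$ (two adjacent bars on the same edge are created or deleted); and $T_3$ (whose effect on Gauss diagrams is: a chord has its direction reversed, its sign kept, and one bar is added on each of the four circle segments adjacent to its two endpoints, or the inverse). The moves $V_1$--$V_4,T_1$ do not change Gauss diagrams, and two diagrams are equivalent iff their Gauss diagrams are related by finitely many moves $R_1,R_2,R_3,T_2,T_3$ (no bars lie between the endpoints required to be adjacent in $R_1,R_2,R_3$). A twisted knot is an equivalence class of diagrams.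 A trivial twisted knot is the classical unknot (crossingless circle) with no bar or with one bar. **Arc shift move.** An arc $(a,b)$ of a diagram is a segment of the curve passing through exactly one pair of crossings $(c_1,c_2)$ (each classical or virtual), with end $a$ incident to $c_1$ and end $b$ incident to $c_2$; bars may or may not lie between the two crossings. The arc shift move on $(a,b)$ cuts the arc at two points near $a$ and near $b$ and reconnects the four loose ends so that the middle piece is traversed in the opposite direction; the middle piece, with its bars and the over/under information at $c_1,c_2$, is left in place, and all newly created crossings are virtual. Effect on the Gauss diagram: the order along the knot of the two endpoints belonging to the arc is interchanged (bars between them remain between them), and the signs of those of $c_1,c_2$ that are classical are changed (for $c_1\ne c_2$). **Arc shift number.** For a diagram $D$, $A(D)$ is the minimum number of arc shift moves required, together with any number of extended Reidemeister moves, to transform $D$ into a diagram of a trivial twisted knot. For a twisted knot $K$, $A(K)=\min\{A(D): D \text{ represents } K\}$. **Unknotting sequence.** A finite sequence of twisted knots ending in a trivial twisted knot, in which each term after the first is obtained from the preceding one by a single arc shift move together with extended Reidemeister moves. *)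

theory Defs
  imports Main "HOL-Library.Multiset" "HOL-Library.Extended_Nat"
begin

text \<open>
  Twisted knots are treated through Gauss diagrams: two twisted knot diagrams are equivalent under
  the extended Reidemeister moves iff their Gauss diagrams are related by the moves below
  (the virtual moves and \<open>T1\<close> leave the Gauss diagram unchanged), and every Gauss diagram comes from
  a twisted knot diagram.  A Gauss diagram is written as the list of marks met when travelling once
  along the oriented circle from some base point; \<open>Endpoint r c s\<close> is the over or under endpoint of
  the chord named \<open>c\<close>, whose sign is \<open>s\<close>.
\<close>

datatype strand = Over | Under

datatype 'c mark = Bar | Endpoint strand 'c int

type_synonym code = "nat mark list"

definition chords :: "code \<Rightarrow> nat set" where
  "chords w = (\<Union>x\<in>set w. set_mark x)"

definition gauss_diagram :: "code \<Rightarrow> bool" where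
  "gauss_diagram w \<longleftrightarrow> (\<forall>c\<in>chords w. \<exists>s\<in>{1, -1}.
     mset (filter (\<lambda>x. c \<in> set_mark x) w) = {#Endpoint Over c s, Endpoint Under c s#})"

fun opposite :: "strand \<Rightarrow> strand" where
  "opposite Over = Under"
| "opposite Under = Over"

fun reverse_chord :: "nat mark \<Rightarrow> nat mark" where
  "reverse_chord Bar = Bar"
| "reverse_chord (Endpoint r c s) = Endpoint (opposite r) c s"

fun negate_sign :: "nat mark \<Rightarrow> nat mark" where
  "negate_sign Bar = Bar"
| "negate_sign (Endpoint r c s) = Endpoint r c (- s)"

definition change_signs :: "nat set \<Rightarrow> code \<Rightarrow> code" where
  "change_signs C = map (\<lambda>x. if set_mark x \<inter> C \<noteq> {} then negate_sign x else x)"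

definition in_order :: "int \<Rightarrow> code \<Rightarrow> code" where
  "in_order s w = (if s > 0 then w else rev w)"

text \<open>
  \<open>R3\<close>: the top strand crosses over the middle one at \<open>a\<close> and over the bottom one at \<open>b\<close>; the
  middle strand crosses over the bottom one at \<open>c\<close>.  If the strands are lines with directions
  \<open>t\<close>, \<open>m\<close>, \<open>l\<close>, then the signs of \<open>a\<close>, \<open>b\<close>, \<open>c\<close> are those of the cross products \<open>t \<times> m\<close>,
  \<open>t \<times> l\<close>, \<open>m \<times> l\<close>; all eight combinations occur.  Computing the intersection points shows that,
  on one of the two sides of the move, \<open>a\<close> precedes \<open>b\<close> on the top strand iff \<open>sb = 1\<close>,
  \<open>a\<close> precedes \<open>c\<close> on the middle strand iff \<open>sc = 1\<close>, and \<open>b\<close> precedes \<open>c\<close> on the bottom strand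
  iff \<open>sa * sb * sc = 1\<close>.  On the other side of the move all three orders are reversed.
\<close>

definition top_strand :: "nat \<Rightarrow> nat \<Rightarrow> int \<Rightarrow> int \<Rightarrow> code" where
  "top_strand a b sa sb = in_order sb [Endpoint Over a sa, Endpoint Over b sb]"

definition middle_strand :: "nat \<Rightarrow> nat \<Rightarrow> int \<Rightarrow> int \<Rightarrow> code" where
  "middle_strand a c sa sc = in_order sc [Endpoint Under a sa, Endpoint Over c sc]"

definition bottom_strand :: "nat \<Rightarrow> nat \<Rightarrow> int \<Rightarrow> int \<Rightarrow> int \<Rightarrow> code" where
  "bottom_strand b c sa sb sc =
     in_order (sa * sb * sc) [Endpoint Under b sb, Endpoint Under c sc]"

text \<open>
  The rules \<open>base_point\<close> and \<open>rename\<close> relate codes of the same Gauss diagram; with \<open>base_point\<close>,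
  the other moves may be stated at the start of the code.  Each move is used below only between
  codes that are both Gauss diagrams, and in both directions; in particular the chords named on
  the left of \<open>R1\<close> and \<open>R2\<close> are then pairwise distinct and do not occur on the right.
  In \<open>T3\<close>, if the two endpoints of the chord bound a common segment, this segment receives two
  bars, one at each end.
\<close>

inductive move :: "code \<Rightarrow> code \<Rightarrow> bool" where
  base_point: "move (x @ y) (y @ x)"
| rename: "inj_on f (chords w) \<Longrightarrow> move w (map (map_mark f) w)"
| R1: "move ([Endpoint r c s, Endpoint (opposite r) c s] @ w) w"
| R2_parallel:
    "move ([Endpoint Over c s, Endpoint Over d (- s)] @ x @
           [Endpoint Under c s, Endpoint Under d (- s)] @ y) (x @ y)"
| R2_antiparallel:
    "move ([Endpoint Over c s, Endpoint Over d (- s)] @ x @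
           [Endpoint Under d (- s), Endpoint Under c s] @ y) (x @ y)"
| R3_top_middle_bottom:
    "\<lbrakk>t = top_strand a b sa sb; m = middle_strand a c sa sc; l = bottom_strand b c sa sb sc\<rbrakk>
     \<Longrightarrow> move (t @ x @ m @ y @ l @ z) (rev t @ x @ rev m @ y @ rev l @ z)"
| R3_top_bottom_middle:
    "\<lbrakk>t = top_strand a b sa sb; m = middle_strand a c sa sc; l = bottom_strand b c sa sb sc\<rbrakk>
     \<Longrightarrow> move (t @ x @ l @ y @ m @ z) (rev t @ x @ rev l @ y @ rev m @ z)"
| T2: "move ([Bar, Bar] @ w) w"
| T3: "c \<in> chords w \<Longrightarrow>
       move w (concat (map (\<lambda>x. if c \<in> set_mark x then [Bar, reverse_chord x, Bar] else [x]) w))"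

definition diagram_equiv :: "code \<Rightarrow> code \<Rightarrow> bool" where
  "diagram_equiv D E \<longleftrightarrow> gauss_diagram D \<and> gauss_diagram E \<and>
     equivclp (\<lambda>D E. gauss_diagram D \<and> gauss_diagram E \<and> move D E) D E"

type_synonym knot = "code set"

definition knot_of :: "code \<Rightarrow> knot" where
  "knot_of D = {E. diagram_equiv D E}"

definition twisted_knots :: "knot set" where
  "twisted_knots = knot_of ` {D. gauss_diagram D}"

definition trivial_knot :: knot where
  "trivial_knot = knot_of []"

definition trivial_knot_with_bar :: knot where
  "trivial_knot_with_bar = knot_of [Bar]"

text \<open>
  The crossings \<open>c1\<close>, \<open>c2\<close> at the two ends of an arc may be virtual, and virtual crossings are not
  recorded in the code; a passage through a virtual crossing is therefore the empty list.
  A virtual crossing can be placed anywhere on the curve by virtual moves and \<open>T1\<close>, so no condition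
  restricts its position.  If one of the two crossings is virtual, the bars between them thus move
  to the other side of the endpoint of the classical crossing.
  Reversing the arc reverses one of the two strands at each end crossing and hence changes its
  sign; if \<open>c1 = c2\<close>, both strands are reversed there and the sign is kept.
\<close>

definition passage :: "code \<Rightarrow> bool" where
  "passage w \<longleftrightarrow> w = [] \<or> (\<exists>r c s. w = [Endpoint r c s])"

inductive arc_shift :: "code \<Rightarrow> code \<Rightarrow> bool" where
  "\<lbrakk>passage p; passage q; C = (chords p - chords q) \<union> (chords q - chords p)\<rbrakk>
   \<Longrightarrow> arc_shift (p @ replicate k Bar @ q @ w)
                 (change_signs C (q @ replicate k Bar @ p @ w))"

definition arc_shift_step :: "code \<Rightarrow> code \<Rightarrow> bool" where
  "arc_shift_step = diagram_equiv OO arc_shift OO diagram_equiv"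

text \<open>The infimum is \<open>\<infinity>\<close> if no finite number of arc shift moves suffices.\<close>

definition arc_shift_number_diagram :: "code \<Rightarrow> enat" where
  "arc_shift_number_diagram D =
     Inf {enat k | k E. ((arc_shift_step ^^ k) OO diagram_equiv) D E \<and>
                        E \<in> trivial_knot \<union> trivial_knot_with_bar}"

definition arc_shift_number :: "knot \<Rightarrow> enat" where
  "arc_shift_number K = (INF D\<in>K. arc_shift_number_diagram D)"

definition knot_arc_shift :: "knot \<Rightarrow> knot \<Rightarrow> bool" where
  "knot_arc_shift K L \<longleftrightarrow> (\<exists>D\<in>K. \<exists>E\<in>L. arc_shift D E)"

definition unknotting_sequence :: "knot list \<Rightarrow> bool" where
  "unknotting_sequence Ks \<longleftrightarrow> Ks \<noteq> [] \<and> set Ks \<subseteq> twisted_knots \<and>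
     last Ks \<in> {trivial_knot, trivial_knot_with_bar} \<and> successively knot_arc_shift Ks"

end

theory Submission
  imports Defs
begin

text \<open>
  The lower bounds come from the odd writhe, that is, the sum of the signs of the odd chords, where
  a chord is odd if the number of chord endpoints between its two ends is odd.  It ignores the bars
  and is preserved by every move: the chord of an \<open>R1\<close> kink is even; the two chords of an
  \<open>R2\<close> move have the same parity and opposite signs; in an \<open>R3\<close> move each of the three chords takes
  part in two transpositions of neighbouring endpoints, so its parity changes twice; \<open>T2\<close> changes
  only bars; and \<open>T3\<close> changes only bars and the direction of a chord (\<open>doubled_odd_writhe_move\<close>).

  An arc shift changes the odd writhe by at most \<open>2\<close>.  If both crossings are classical and distinct,
  each of the two chords changes sign and parity at once: an odd chord of sign \<open>s\<close> becomes even, and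
  an even one becomes odd of sign \<open>- s\<close>.  Either way the chord contributes \<open>- s\<close> to the change.  If
  just one crossing is virtual, one chord changes sign and keeps its parity, which changes the odd writhe
  by \<open>0\<close> or \<open>\<plusminus>2\<close>.  In the other cases nothing changes.  The odd writhe vanishes on both trivial knots,
  so a knot of odd writhe \<open>2 * n\<close> has arc shift number at least \<open>n\<close>
  (\<open>arc_shift_number_lower_bound\<close>).

  The bound is attained by the composite of \<open>n\<close> virtual trefoils, with Gauss code a
  concatenation of \<open>n\<close> blocks \<open>Oa Ob Ua Ub\<close> with all signs positive.  Each block has two odd chords.
  Shifting the arc \<open>Oa Ob\<close> turns a block into \<open>Ob Oa Ua Ub\<close>, which two \<open>R1\<close> moves erase; so one
  arc shift removes one block (\<open>arc_shift_trefoil_chain\<close>), and \<open>n\<close> of them leave the crossingless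
  circle.  Appending a single bar to the code gives the second sequence.  The two sequences differ
  because every move preserves the parity of the number of bars, which separates the trivial knots.
\<close>

section \<open>Gauss diagrams\<close>

lemma chords_simps [simp]:
  "chords [] = {}"
  "chords (x # w) = set_mark x \<union> chords w"
  "chords (v @ w) = chords v \<union> chords w"
  by (auto simp: chords_def)

lemma chords_rev [simp]: "chords (rev w) = chords w"
  by (simp add: chords_def)

lemma chords_replicate_Bar [simp]: "chords (replicate k Bar) = {}"
  by (auto simp: chords_def)

lemma finite_set_mark [simp]: "finite (set_mark x)"
  by (cases x) auto

lemma finite_chords [simp]: "finite (chords w)"
  by (simp add: chords_def)

lemma filter_chord_empty: "c \<notin> chords w \<Longrightarrow> filter (\<lambda>x. c \<in> set_mark x) w = []"
  by (auto simp: chords_def filter_empty_conv)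

lemma gauss_diagram_mset_cong:
  assumes "mset v = mset w"
  shows "gauss_diagram v \<longleftrightarrow> gauss_diagram w"
proof -
  have "chords v = chords w"
    using mset_eq_setD[OF assms] by (simp add: chords_def)
  then show ?thesis
    by (simp add: gauss_diagram_def assms)
qed

lemma gauss_diagram_append:
  assumes "gauss_diagram v" "gauss_diagram w" "chords v \<inter> chords w = {}"
  shows "gauss_diagram (v @ w)"
  unfolding gauss_diagram_def
proof
  fix c assume "c \<in> chords (v @ w)"
  then consider "c \<in> chords v" "c \<notin> chords w" | "c \<in> chords w" "c \<notin> chords v"
    using assms(3) by auto
  then show "\<exists>s\<in>{1, -1}. mset (filter (\<lambda>x. c \<in> set_mark x) (v @ w)) =
      {#Endpoint Over c s, Endpoint Under c s#}"
  proof cases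
    case 1
    then show ?thesis
      using assms(1) by (simp add: gauss_diagram_def filter_chord_empty)
  next
    case 2
    then show ?thesis
      using assms(2) by (simp add: gauss_diagram_def filter_chord_empty)
  qed
qed

lemma gauss_diagram_length_filter:
  assumes "gauss_diagram w"
  shows "length (filter (\<lambda>x. c \<in> set_mark x) w) = (if c \<in> chords w then 2 else 0)"
proof (cases "c \<in> chords w")
  case True
  then obtain s where
    "mset (filter (\<lambda>x. c \<in> set_mark x) w) = {#Endpoint Over c s, Endpoint Under c s#}"
    using assms by (auto simp: gauss_diagram_def)
  from arg_cong[OF this, of size] show ?thesis
    using True by (simp del: mset_filter)
qed (simp add: filter_chord_empty)

text \<open>
The moves \<open>R2\<close> and \<open>R3\<close> are stated for arbitrary chord names.  Any two of the chords they name have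
endpoints of the same strand at different places, so they are distinct in a Gauss diagram.
\<close>

lemma gauss_diagram_strand_unique:
  assumes "gauss_diagram w"
  shows "length (filter (\<lambda>x. \<exists>s. x = Endpoint r c s) w) \<le> 1"
proof (cases "c \<in> chords w")
  case True
  then obtain s where s:
    "mset (filter (\<lambda>x. c \<in> set_mark x) w) = {#Endpoint Over c s, Endpoint Under c s#}"
    using assms by (auto simp: gauss_diagram_def)
  have "filter (\<lambda>x. \<exists>s. x = Endpoint r c s) w =
      filter (\<lambda>x. \<exists>s. x = Endpoint r c s) (filter (\<lambda>x. c \<in> set_mark x) w)"
    by (auto simp: filter_filter intro!: filter_cong)
  then have "mset (filter (\<lambda>x. \<exists>s. x = Endpoint r c s) w) =
      filter_mset (\<lambda>x. \<exists>s. x = Endpoint r c s) {#Endpoint Over c s, Endpoint Under c s#}"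
    by (metis s mset_filter)
  from arg_cong[OF this, of size] show ?thesis
    by (cases r) (simp_all del: mset_filter)
next
  case False
  then have "filter (\<lambda>x. \<exists>s. x = Endpoint r c s) w = []"
    by (auto simp: filter_empty_conv chords_def)
  then show ?thesis
    by simp
qed

section \<open>Odd chords and the odd writhe\<close>

text \<open>
The parity of a chord is read off from the positions of its endpoints, counted without the bars:
the number of endpoints strictly between two endpoints is odd iff their positions have the same
parity.  With each position weighted by an alternating sign, the two weights of a chord add up to
\<open>\<plusminus>2\<close> if the chord is odd and cancel if it is even.  Such alternating sums behave simply under
concatenation, where \<open>parity_sign\<close> is the sign by which a prefix shifts the weights of what follows.
\<close>

definition parity_sign :: "code \<Rightarrow> int" where
  "parity_sign w = (-1) ^ length (filter (\<lambda>x. x \<noteq> Bar) w)"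

lemma parity_sign_simps [simp]:
  "parity_sign [] = 1"
  "parity_sign (Bar # w) = parity_sign w"
  "parity_sign (Endpoint r c s # w) = - parity_sign w"
  "parity_sign (v @ w) = parity_sign v * parity_sign w"
  "parity_sign (rev w) = parity_sign w"
  "parity_sign (replicate k Bar) = 1"
  by (simp_all add: parity_sign_def power_add flip: rev_filter)

lemma parity_sign_cases: "parity_sign w = 1 \<or> parity_sign w = -1"
  by (simp add: parity_sign_def minus_one_power_iff)

fun alternating_count :: "nat \<Rightarrow> code \<Rightarrow> int" where
  "alternating_count c [] = 0"
| "alternating_count c (Bar # w) = alternating_count c w"
| "alternating_count c (Endpoint r d s # w) = of_bool (d = c) - alternating_count c w"

definition odd_chord :: "nat \<Rightarrow> code \<Rightarrow> bool" where
  "odd_chord c w \<longleftrightarrow> alternating_count c w \<noteq> 0"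

fun mark_sign :: "nat mark \<Rightarrow> int" where
  "mark_sign Bar = 0"
| "mark_sign (Endpoint r c s) = s"

definition sign_sum :: "nat \<Rightarrow> code \<Rightarrow> int" where
  "sign_sum c w = sum_list (map mark_sign (filter (\<lambda>x. c \<in> set_mark x) w))"

text \<open>
Both endpoints of a chord carry its sign, so in a Gauss diagram \<open>sign_sum\<close> is twice the sign of the
chord and the sum below is twice the odd writhe.  Counting both endpoints makes the sign
contribution additive in the code and independent of the direction of the chord.
\<close>

definition doubled_odd_writhe :: "code \<Rightarrow> int" where
  "doubled_odd_writhe w = (\<Sum>c\<in>chords w. of_bool (odd_chord c w) * sign_sum c w)"

lemma alternating_count_append [simp]:
  "alternating_count c (v @ w) = alternating_count c v + parity_sign v * alternating_count c w"
  by (induction c v rule: alternating_count.induct) (simp_all add: algebra_simps)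

lemma alternating_count_notin [simp]: "c \<notin> chords w \<Longrightarrow> alternating_count c w = 0"
  by (induction c w rule: alternating_count.induct) auto

lemma alternating_count_once:
  assumes "length (filter (\<lambda>x. c \<in> set_mark x) w) = 1"
  shows "alternating_count c w = 1 \<or> alternating_count c w = -1"
  using assms
proof (induction c w rule: alternating_count.induct)
  case (3 c r d s w)
  show ?case
  proof (cases "d = c")
    case True
    with 3 have "c \<notin> chords w"
      by (auto simp: chords_def filter_empty_conv)
    with True show ?thesis
      by simp
  qed (use 3 in auto)
qed auto

lemma sign_sum_simps [simp]:
  "sign_sum c [] = 0"
  "sign_sum c (x # w) = (if c \<in> set_mark x then mark_sign x else 0) + sign_sum c w"
  "sign_sum c (v @ w) = sign_sum c v + sign_sum c w"
  "sign_sum c (replicate k Bar) = 0"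
  by (simp_all add: sign_sum_def)

lemma sign_sum_rev [simp]: "sign_sum c (rev w) = sign_sum c w"
  by (simp add: sign_sum_def sum_list_rev flip: rev_filter rev_map)

lemma sign_sum_notin [simp]: "c \<notin> chords w \<Longrightarrow> sign_sum c w = 0"
  by (simp add: sign_sum_def filter_chord_empty)

lemma sign_sum_gauss_diagram:
  assumes "gauss_diagram w" "c \<in> chords w"
  shows "sign_sum c w = 2 \<or> sign_sum c w = -2"
proof -
  obtain s where s: "s = 1 \<or> s = -1"
    "mset (filter (\<lambda>x. c \<in> set_mark x) w) = {#Endpoint Over c s, Endpoint Under c s#}"
    using assms by (auto simp: gauss_diagram_def)
  have "sign_sum c w = sum_mset (image_mset mark_sign (mset (filter (\<lambda>x. c \<in> set_mark x) w)))"
    by (simp only: sign_sum_def sum_mset_sum_list flip: mset_map)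
  then show ?thesis
    using s by auto
qed

lemma doubled_odd_writhe_cong:
  assumes "chords v = chords w"
    and "\<And>c. c \<in> chords w \<Longrightarrow> odd_chord c v \<longleftrightarrow> odd_chord c w"
    and "\<And>c. c \<in> chords w \<Longrightarrow> sign_sum c v = sign_sum c w"
  shows "doubled_odd_writhe v = doubled_odd_writhe w"
  unfolding doubled_odd_writhe_def by (rule sum.cong) (use assms in auto)

section \<open>Invariance under the extended Reidemeister moves\<close>

text \<open>
Every chord has two endpoints, so their total number is even.  Hence the parity of a chord does not
depend on which of the two arcs between its endpoints is used, nor on the base point.
\<close>

lemma gauss_diagram_parity_sign:
  assumes "gauss_diagram w"
  shows "parity_sign w = 1"
proof -
  have "length (filter (\<lambda>x. x \<noteq> Bar) w) =
      (\<Sum>c\<in>chords w. length (filter (\<lambda>x. c \<in> set_mark x) w))"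
  proof -
    \<comment> \<open>The index set of the sum is kept fixed, since \<open>chords v\<close> changes along the induction.\<close>
    have "length (filter (\<lambda>x. x \<noteq> Bar) v) =
        (\<Sum>c\<in>A. length (filter (\<lambda>x. c \<in> set_mark x) v))"
      if "finite A" "chords v \<subseteq> A" for A v
      using that(2)
    proof (induction v)
      case (Cons x v)
      show ?case
      proof (cases x)
        case Bar
        with Cons show ?thesis by simp
      next
        case (Endpoint r d s)
        have "(\<Sum>c\<in>A. length (filter (\<lambda>x. c \<in> set_mark x) (x # v))) =
            (\<Sum>c\<in>A. (if c = d then 1 else 0) + length (filter (\<lambda>x. c \<in> set_mark x) v))"
          by (rule sum.cong) (auto simp: Endpoint)
        also have "\<dots> = Suc (\<Sum>c\<in>A. length (filter (\<lambda>x. c \<in> set_mark x) v))"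
          using Cons.prems that(1) by (simp add: sum.distrib Endpoint)
        finally show ?thesis
          using Cons Endpoint by simp
      qed
    qed simp
    then show ?thesis by simp
  qed
  also have "\<dots> = (\<Sum>c\<in>chords w. 2)"
    by (rule sum.cong) (simp_all add: gauss_diagram_length_filter[OF assms])
  finally show ?thesis
    by (simp add: parity_sign_def)
qed

text \<open>
Moving the base point multiplies all alternating sums by a common sign.
\<close>

lemma doubled_odd_writhe_base_point:
  assumes "gauss_diagram (x @ y)"
  shows "doubled_odd_writhe (x @ y) = doubled_odd_writhe (y @ x)"
proof (rule doubled_odd_writhe_cong)
  fix c
  have "parity_sign x * parity_sign y = 1"
    using gauss_diagram_parity_sign[OF assms] by simp
  then have "parity_sign x = parity_sign y" "parity_sign y * parity_sign y = 1"
    using parity_sign_cases[of x] parity_sign_cases[of y] by auto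
  then have "alternating_count c (x @ y) = parity_sign y * alternating_count c (y @ x)"
    by (simp add: algebra_simps flip: mult.assoc)
  then show "odd_chord c (x @ y) \<longleftrightarrow> odd_chord c (y @ x)"
    using parity_sign_cases[of y] by (auto simp: odd_chord_def)
qed auto

lemma chords_map_mark: "chords (map (map_mark f) w) = f ` chords w"
  by (auto simp: chords_def mark.set_map)

lemma doubled_odd_writhe_rename:
  assumes "inj_on f (chords w)"
  shows "doubled_odd_writhe (map (map_mark f) w) = doubled_odd_writhe w"
proof -
  have alternating: "alternating_count (f c) (map (map_mark f) v) = alternating_count c v"
    if "c \<in> chords w" "chords v \<subseteq> chords w" for c v
    using that
  proof (induction c v rule: alternating_count.induct)
    case (3 c r d s v)
    then have "f d = f c \<longleftrightarrow> d = c"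
      using assms by (auto dest: inj_onD)
    with 3 show ?case by simp
  qed simp_all
  have sign: "sign_sum (f c) (map (map_mark f) v) = sign_sum c v"
    if "c \<in> chords w" "chords v \<subseteq> chords w" for c v
    using that(2)
  proof (induction v)
    case (Cons x v)
    show ?case
    proof (cases x)
      case (Endpoint r d s)
      then have "f c = f d \<longleftrightarrow> c = d"
        using assms Cons.prems that(1) by (auto dest: inj_onD)
      with Cons Endpoint show ?thesis by simp
    qed (use Cons in simp)
  qed simp
  show ?thesis
    unfolding doubled_odd_writhe_def chords_map_mark odd_chord_def
    using assms by (subst sum.reindex) (auto simp: alternating sign intro!: sum.cong)
qed

text \<open>
The chord of a kink has adjacent endpoints and is even; the two endpoints together do not shift the
parity of any later position.
\<close>

lemma doubled_odd_writhe_R1: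
  assumes "gauss_diagram ([Endpoint r c s, Endpoint (opposite r) c s] @ w)"
  shows "doubled_odd_writhe ([Endpoint r c s, Endpoint (opposite r) c s] @ w) =
    doubled_odd_writhe w"
proof -
  let ?v = "[Endpoint r c s, Endpoint (opposite r) c s] @ w"
  have c: "c \<notin> chords w"
    using gauss_diagram_length_filter[OF assms, of c] by (auto simp: chords_def filter_empty_conv)
  have "doubled_odd_writhe ?v = of_bool (odd_chord c ?v) * sign_sum c ?v +
      (\<Sum>e\<in>chords w. of_bool (odd_chord e ?v) * sign_sum e ?v)"
    using c by (simp add: doubled_odd_writhe_def)
  also have "(\<Sum>e\<in>chords w. of_bool (odd_chord e ?v) * sign_sum e ?v) = doubled_odd_writhe w"
    unfolding doubled_odd_writhe_def by (rule sum.cong) (use c in \<open>auto simp: odd_chord_def\<close>)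
  finally show ?thesis
    using c by (simp add: odd_chord_def)
qed

text \<open>
The endpoints of \<open>c\<close> and \<open>d\<close> are neighbours at both places, so the two chords have the same parity,
and their opposite signs cancel.
\<close>

lemma doubled_odd_writhe_R2:
  assumes gauss: "gauss_diagram
      ([Endpoint Over c s, Endpoint Over d (- s)] @ x @ l @ y)" (is "gauss_diagram ?v")
    and l: "l = [Endpoint Under c s, Endpoint Under d (- s)] \<or>
      l = [Endpoint Under d (- s), Endpoint Under c s]"
  shows "doubled_odd_writhe ?v = doubled_odd_writhe (x @ y)"
proof -
  have "c \<noteq> d"
    using gauss_diagram_strand_unique[OF gauss, of Over c] by auto
  moreover have c: "c \<notin> chords x" "c \<notin> chords y"
    using gauss_diagram_length_filter[OF gauss, of c] \<open>c \<noteq> d\<close> l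
    by (auto simp: chords_def filter_empty_conv)
  moreover have d: "d \<notin> chords x" "d \<notin> chords y"
    using gauss_diagram_length_filter[OF gauss, of d] \<open>c \<noteq> d\<close> l
    by (auto simp: chords_def filter_empty_conv)
  moreover have "chords ?v = insert c (insert d (chords (x @ y)))"
    using l by auto
  ultimately have "doubled_odd_writhe ?v = of_bool (odd_chord c ?v) * sign_sum c ?v +
      of_bool (odd_chord d ?v) * sign_sum d ?v +
      (\<Sum>e\<in>chords (x @ y). of_bool (odd_chord e ?v) * sign_sum e ?v)"
    by (simp add: doubled_odd_writhe_def)
  moreover have "odd_chord c ?v = odd_chord d ?v"
    using c d \<open>c \<noteq> d\<close> l by (auto simp: odd_chord_def)
  moreover have "sign_sum c ?v = - sign_sum d ?v"
    using c d \<open>c \<noteq> d\<close> l by auto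
  moreover have "(\<Sum>e\<in>chords (x @ y). of_bool (odd_chord e ?v) * sign_sum e ?v) =
      doubled_odd_writhe (x @ y)"
    unfolding doubled_odd_writhe_def
    by (rule sum.cong) (use c d l in \<open>auto simp: odd_chord_def\<close>)
  ultimately show ?thesis
    by simp
qed

definition two_endpoints :: "code \<Rightarrow> bool" where
  "two_endpoints v \<longleftrightarrow> (\<exists>r c s r' c' s'. v = [Endpoint r c s, Endpoint r' c' s'])"

lemma alternating_count_rev_two_endpoints:
  "two_endpoints v \<Longrightarrow> alternating_count c (rev v) = - alternating_count c v"
  by (auto simp: two_endpoints_def)

text \<open>
Reversing a strand with two endpoints transposes them, which negates its alternating sums.  In an
\<open>R3\<close> move the chords of the three strands have no endpoints elsewhere, so their alternating sums are
negated as a whole; the sums of the other chords get nothing from the three strands.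
\<close>

lemma doubled_odd_writhe_reverse_three:
  assumes two: "two_endpoints t" "two_endpoints m" "two_endpoints l"
    and disjoint: "(chords t \<union> chords m \<union> chords l) \<inter> (chords x \<union> chords y \<union> chords z) = {}"
  shows "doubled_odd_writhe (t @ x @ m @ y @ l @ z) =
    doubled_odd_writhe (rev t @ x @ rev m @ y @ rev l @ z)" (is "doubled_odd_writhe ?v = doubled_odd_writhe ?w")
proof (rule doubled_odd_writhe_cong)
  fix e
  show "odd_chord e ?v \<longleftrightarrow> odd_chord e ?w"
  proof (cases "e \<in> chords t \<union> chords m \<union> chords l")
    case True
    with disjoint have "e \<notin> chords x" "e \<notin> chords y" "e \<notin> chords z"
      by auto
    then have "alternating_count e ?w = - alternating_count e ?v"
      by (simp add: alternating_count_rev_two_endpoints two algebra_simps)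
    then show ?thesis
      by (simp only: odd_chord_def neg_equal_0_iff_equal)
  next
    case False
    then show ?thesis
      by (simp add: odd_chord_def)
  qed
qed auto

lemma strand_simps:
  "chords (top_strand a b sa sb) = {a, b}"
  "chords (middle_strand a c sa sc) = {a, c}"
  "chords (bottom_strand b c sa sb sc) = {b, c}"
  "length (filter P (top_strand a b sa sb)) =
    length (filter P [Endpoint Over a sa, Endpoint Over b sb])"
  "length (filter P (middle_strand a c sa sc)) =
    length (filter P [Endpoint Under a sa, Endpoint Over c sc])"
  "length (filter P (bottom_strand b c sa sb sc)) =
    length (filter P [Endpoint Under b sb, Endpoint Under c sc])"
  by (auto simp: top_strand_def middle_strand_def bottom_strand_def in_order_def)

lemma two_endpoints_strand:
  "two_endpoints (top_strand a b sa sb)"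
  "two_endpoints (middle_strand a c sa sc)"
  "two_endpoints (bottom_strand b c sa sb sc)"
  by (auto simp: top_strand_def middle_strand_def bottom_strand_def in_order_def two_endpoints_def)

lemma doubled_odd_writhe_R3:
  assumes "gauss_diagram (t @ x @ u @ y @ v @ z)"
    and t: "t = top_strand a b sa sb"
    and uv: "u = middle_strand a c sa sc \<and> v = bottom_strand b c sa sb sc \<or>
      u = bottom_strand b c sa sb sc \<and> v = middle_strand a c sa sc"
  shows "doubled_odd_writhe (t @ x @ u @ y @ v @ z) =
    doubled_odd_writhe (rev t @ x @ rev u @ y @ rev v @ z)"
proof (rule doubled_odd_writhe_reverse_three)
  show "two_endpoints t" "two_endpoints u" "two_endpoints v"
    using t uv by (auto simp: two_endpoints_strand)
  have "a \<noteq> b" "a \<noteq> c" "b \<noteq> c"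
    using gauss_diagram_strand_unique[OF assms(1), of Over a]
      gauss_diagram_strand_unique[OF assms(1), of Under b] uv unfolding t
    by (elim disjE conjE; hypsubst; auto simp: strand_simps)+
  have "e \<notin> chords x \<and> e \<notin> chords y \<and> e \<notin> chords z" if "e \<in> {a, b, c}" for e
    using gauss_diagram_length_filter[OF assms(1), of e] that t uv \<open>a \<noteq> b\<close> \<open>a \<noteq> c\<close> \<open>b \<noteq> c\<close>
    by (auto simp: strand_simps) (auto simp: chords_def filter_empty_conv)
  moreover have "chords t \<union> chords u \<union> chords v = {a, b, c}"
    using t uv by (auto simp: strand_simps)
  ultimately show "(chords t \<union> chords u \<union> chords v) \<inter> (chords x \<union> chords y \<union> chords z) = {}"
    by blast
qed

lemma doubled_odd_writhe_T3:
  "doubled_odd_writhe (concat (map (\<lambda>x. if c \<in> set_mark x then [Bar, reverse_chord x, Bar] else [x]) w))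
    = doubled_odd_writhe w" (is "doubled_odd_writhe (?T w) = _")
proof (rule doubled_odd_writhe_cong)
  have reverse: "set_mark (reverse_chord x) = set_mark x" "mark_sign (reverse_chord x) = mark_sign x"
    for x by (cases x; simp)+
  show "chords (?T w) = chords w"
    by (induction w) (auto simp: reverse)
  fix e
  have "alternating_count e (?T w) = alternating_count e w"
    by (induction e w rule: alternating_count.induct) auto
  then show "odd_chord e (?T w) \<longleftrightarrow> odd_chord e w"
    by (simp add: odd_chord_def)
  show "sign_sum e (?T w) = sign_sum e w"
    by (induction w) (auto simp: reverse)
qed

lemma doubled_odd_writhe_move:
  assumes "move v w" "gauss_diagram v"
  shows "doubled_odd_writhe v = doubled_odd_writhe w"
  using assms
proof cases
  case (base_point x y)
  then show ?thesis using doubled_odd_writhe_base_point assms(2) by simp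
next
  case (rename f)
  then show ?thesis using doubled_odd_writhe_rename by simp
next
  case (R1 r c s)
  then show ?thesis using doubled_odd_writhe_R1 assms(2) by blast
next
  case (R2_parallel c s d x y)
  then show ?thesis using doubled_odd_writhe_R2 assms(2) by blast
next
  case (R2_antiparallel c s d x y)
  then show ?thesis using doubled_odd_writhe_R2 assms(2) by blast
next
  case (R3_top_middle_bottom t a b sa sb m c sc l x y z)
  then show ?thesis using doubled_odd_writhe_R3 assms(2) by blast
next
  case (R3_top_bottom_middle t a b sa sb m c sc l x y z)
  then show ?thesis using doubled_odd_writhe_R3 assms(2) by blast
next
  case T2
  show ?thesis
    unfolding T2 by (rule doubled_odd_writhe_cong) (auto simp: odd_chord_def)
next
  case (T3 c)
  then show ?thesis using doubled_odd_writhe_T3 by simp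
qed

text \<open>
\<open>T3\<close> adds two bars at each endpoint of the chord, and \<open>T2\<close> adds or removes two.
\<close>

lemma even_bars_move:
  assumes "move v w"
  shows "even (count_list v Bar) \<longleftrightarrow> even (count_list w Bar)"
  using assms
proof cases
  case (rename f)
  have "count_list (map (map_mark f) v) Bar = count_list v Bar"
  proof (induction v)
    case (Cons x v)
    then show ?case by (cases x) auto
  qed simp
  with rename show ?thesis by simp
next
  case (T3 c)
  have "even (count_list v Bar) \<longleftrightarrow> even (count_list
      (concat (map (\<lambda>x. if c \<in> set_mark x then [Bar, reverse_chord x, Bar] else [x]) v)) Bar)"
  proof (induction v)
    case (Cons x v)
    then show ?case by (cases x) auto
  qed simp
  with T3 show ?thesis by simp
qed (auto simp: top_strand_def middle_strand_def bottom_strand_def in_order_def)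

lemma diagram_equiv_invariant:
  assumes "diagram_equiv v w"
    and "\<And>x y. gauss_diagram x \<Longrightarrow> gauss_diagram y \<Longrightarrow> move x y \<Longrightarrow> f x = f y"
  shows "f v = f w"
proof -
  have "equivclp (\<lambda>D E. gauss_diagram D \<and> gauss_diagram E \<and> move D E) v w"
    using assms(1) by (simp add: diagram_equiv_def)
  then show ?thesis
    by (induction rule: equivclp_induct) (auto dest: assms(2))
qed

lemma doubled_odd_writhe_diagram_equiv:
  "diagram_equiv v w \<Longrightarrow> doubled_odd_writhe v = doubled_odd_writhe w"
  by (rule diagram_equiv_invariant) (auto dest: doubled_odd_writhe_move)

section \<open>The effect of an arc shift on the odd writhe\<close>

lemma set_mark_negate_sign [simp]: "set_mark (negate_sign x) = set_mark x"
  by (cases x) auto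

lemma chords_change_signs [simp]: "chords (change_signs C w) = chords w"
  by (auto simp: chords_def change_signs_def)

lemma alternating_count_change_signs [simp]:
  "alternating_count e (change_signs C w) = alternating_count e w"
  by (induction e w rule: alternating_count.induct) (auto simp: change_signs_def)

lemma sign_sum_change_signs [simp]:
  "sign_sum e (change_signs C w) = (if e \<in> C then - sign_sum e w else sign_sum e w)"
proof (induction w)
  case (Cons x w)
  then show ?case by (cases x) (auto simp: change_signs_def)
qed (simp add: change_signs_def)

lemma change_signs_id: "chords w \<inter> C = {} \<Longrightarrow> change_signs C w = w"
  unfolding change_signs_def chords_def by (rule map_idI) (auto simp: disjoint_iff)

lemma doubled_odd_writhe_diff:
  assumes "chords v = chords w" "C \<subseteq> chords w"
    and "\<And>e. e \<in> chords w - C \<Longrightarrow> odd_chord e v \<longleftrightarrow> odd_chord e w"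
    and "\<And>e. e \<in> chords w - C \<Longrightarrow> sign_sum e v = sign_sum e w"
  shows "doubled_odd_writhe v - doubled_odd_writhe w =
    (\<Sum>e\<in>C. of_bool (odd_chord e v) * sign_sum e v - of_bool (odd_chord e w) * sign_sum e w)"
proof -
  have "doubled_odd_writhe v - doubled_odd_writhe w = (\<Sum>e\<in>chords w.
      of_bool (odd_chord e v) * sign_sum e v - of_bool (odd_chord e w) * sign_sum e w)"
    by (simp add: doubled_odd_writhe_def assms(1) sum_subtractf)
  also have "\<dots> = (\<Sum>e\<in>C.
      of_bool (odd_chord e v) * sign_sum e v - of_bool (odd_chord e w) * sign_sum e w)"
    by (rule sum.mono_neutral_right) (use assms in auto)
  finally show ?thesis .
qed

text \<open>
Here one end of the arc is a virtual crossing: bars pass across an endpoint of \<open>c\<close>, which leaves all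
alternating sums unchanged, and the sign of \<open>c\<close> is reversed.
\<close>

lemma doubled_odd_writhe_classical_virtual:
  assumes gauss: "gauss_diagram w" and c: "c \<in> chords w"
    and chords: "chords v = chords w"
    and alternating: "\<And>e. alternating_count e v = alternating_count e w"
    and sign: "\<And>e. sign_sum e v = sign_sum e w"
  shows "\<bar>doubled_odd_writhe (change_signs {c} v) - doubled_odd_writhe w\<bar> \<le> 4"
proof -
  have "doubled_odd_writhe (change_signs {c} v) - doubled_odd_writhe w =
      (\<Sum>e\<in>{c}. of_bool (odd_chord e (change_signs {c} v)) * sign_sum e (change_signs {c} v) -
        of_bool (odd_chord e w) * sign_sum e w)"
    by (rule doubled_odd_writhe_diff)
      (use c in \<open>auto simp: odd_chord_def chords alternating sign\<close>)
  then show ?thesis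
    using sign_sum_gauss_diagram[OF gauss c]
    by (auto simp: odd_chord_def alternating sign of_bool_def)
qed

text \<open>
Each of the two chords changes both sign and parity, so it is odd on exactly one side of the move,
and its part in the difference is minus its original sign in either case.
\<close>

lemma doubled_odd_writhe_two_classical:
  assumes gauss: "gauss_diagram (Endpoint r c s # replicate k Bar @ Endpoint r' d s' # w)"
    (is "gauss_diagram ?w") and "c \<noteq> d"
  shows "\<bar>doubled_odd_writhe (change_signs {c, d}
      (Endpoint r' d s' # replicate k Bar @ Endpoint r c s # w)) - doubled_odd_writhe ?w\<bar> \<le> 4"
    (is "\<bar>doubled_odd_writhe ?v - _\<bar> \<le> _")
proof -
  have diff: "doubled_odd_writhe ?v - doubled_odd_writhe ?w =
      (\<Sum>e\<in>{c, d}. of_bool (odd_chord e ?v) * sign_sum e ?v -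
        of_bool (odd_chord e ?w) * sign_sum e ?w)"
    by (rule doubled_odd_writhe_diff) (auto simp: odd_chord_def)
  \<comment> \<open>The other endpoint of each chord lies in \<open>w\<close> and contributes the same sign \<open>\<plusminus>1\<close> before and after,
    while the endpoint on the arc changes its weight between \<open>1\<close> and \<open>-1\<close>.\<close>
  have once: "length (filter (\<lambda>x. c \<in> set_mark x) w) = 1"
    "length (filter (\<lambda>x. d \<in> set_mark x) w) = 1"
    using gauss_diagram_length_filter[OF gauss, of c] gauss_diagram_length_filter[OF gauss, of d]
      \<open>c \<noteq> d\<close> by auto
  have flip: "odd_chord e ?v \<longleftrightarrow> \<not> odd_chord e ?w" "sign_sum e ?v = - sign_sum e ?w"
    if "e \<in> {c, d}" for e
    using that alternating_count_once[OF once(1)] alternating_count_once[OF once(2)] \<open>c \<noteq> d\<close>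
    by (auto simp: odd_chord_def)
  have "doubled_odd_writhe ?v - doubled_odd_writhe ?w = - sign_sum c ?w - sign_sum d ?w"
    unfolding diff using \<open>c \<noteq> d\<close> flip[of c] flip[of d] by (simp del: sign_sum_simps)
  moreover have "sign_sum e ?w = 2 \<or> sign_sum e ?w = -2" if "e \<in> {c, d}" for e
    using sign_sum_gauss_diagram[OF gauss, of e] that by auto
  ultimately show ?thesis
    by (smt (verit) insertCI)
qed

lemma doubled_odd_writhe_arc_shift:
  assumes "arc_shift v w" "gauss_diagram v"
  shows "\<bar>doubled_odd_writhe w - doubled_odd_writhe v\<bar> \<le> 4"
  using assms(1)
proof cases
  case (1 p q C k w')
  consider "p = []" "q = []"
    | r c s where "p = [Endpoint r c s]" "q = []"
    | r c s where "p = []" "q = [Endpoint r c s]"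
    | r c s r' d s' where "p = [Endpoint r c s]" "q = [Endpoint r' d s']"
    using 1 by (auto simp: passage_def)
  then show ?thesis
  proof cases
    case a: 1
    then show ?thesis
      using 1 by (simp add: change_signs_id)
  next
    case a: (2 r c s)
    have "C = {c}" using 1 a by simp
    then show ?thesis
      using 1 assms(2) a by (auto intro!: doubled_odd_writhe_classical_virtual)
  next
    case a: (3 r c s)
    have "C = {c}" using 1 a by simp
    then show ?thesis
      using 1 assms(2) a by (auto intro!: doubled_odd_writhe_classical_virtual)
  next
    case a: (4 r c s r' d s')
    show ?thesis
    proof (cases "c = d")
      case True
      have "C = {}" using 1 a True by simp
      have "doubled_odd_writhe w = doubled_odd_writhe v"
        unfolding 1 a \<open>C = {}\<close> True
        by (rule doubled_odd_writhe_cong) (auto simp: odd_chord_def change_signs_id)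
      then show ?thesis by simp
    next
      case False
      have "C = {c, d}" using 1 a False by auto
      then show ?thesis
        using 1 a assms(2) False doubled_odd_writhe_two_classical[of r c s k r' d s' w'] by simp
    qed
  qed
qed

lemma doubled_odd_writhe_arc_shift_step:
  assumes "arc_shift_step v w"
  shows "\<bar>doubled_odd_writhe v - doubled_odd_writhe w\<bar> \<le> 4"
proof -
  obtain v' w' where "diagram_equiv v v'" "arc_shift v' w'" "diagram_equiv w' w"
    using assms by (auto simp: arc_shift_step_def)
  moreover from this have "gauss_diagram v'"
    by (simp add: diagram_equiv_def)
  ultimately show ?thesis
    using doubled_odd_writhe_arc_shift[of v' w'] doubled_odd_writhe_diagram_equiv[of v v']
      doubled_odd_writhe_diagram_equiv[of w' w] by simp
qed

lemma doubled_odd_writhe_arc_shift_steps: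
  "(arc_shift_step ^^ k) v w \<Longrightarrow> \<bar>doubled_odd_writhe v - doubled_odd_writhe w\<bar> \<le> 4 * int k"
proof (induction k arbitrary: w)
  case (Suc k)
  then obtain u where "(arc_shift_step ^^ k) v u" "arc_shift_step u w"
    by auto
  with Suc.IH[of u] doubled_odd_writhe_arc_shift_step[of u w] show ?case
    by simp
qed simp

text \<open>
An arc shift changes the doubled odd writhe by at most \<open>4\<close>, and it has to be brought down to \<open>0\<close>.
\<close>

lemma arc_shift_number_lower_bound:
  assumes "4 * int n \<le> \<bar>doubled_odd_writhe D\<bar>"
  shows "enat n \<le> arc_shift_number (knot_of D)"
  unfolding arc_shift_number_def
proof (rule INF_greatest)
  fix D' assume "D' \<in> knot_of D"
  then have D': "doubled_odd_writhe D' = doubled_odd_writhe D"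
    using doubled_odd_writhe_diagram_equiv by (simp add: knot_of_def)
  show "enat n \<le> arc_shift_number_diagram D'"
    unfolding arc_shift_number_diagram_def
  proof (rule Inf_greatest, elim CollectE exE conjE)
    fix i k E assume i: "i = enat k" and kE: "((arc_shift_step ^^ k) OO diagram_equiv) D' E"
      "E \<in> trivial_knot \<union> trivial_knot_with_bar"
    obtain F where F: "(arc_shift_step ^^ k) D' F" "diagram_equiv F E"
      using kE(1) by auto
    have "doubled_odd_writhe E = 0"
      using kE(2) doubled_odd_writhe_diagram_equiv[of "[]" E]
        doubled_odd_writhe_diagram_equiv[of "[Bar]" E]
      by (auto simp: trivial_knot_def trivial_knot_with_bar_def knot_of_def doubled_odd_writhe_def)
    then show "enat n \<le> i"
      unfolding i using doubled_odd_writhe_arc_shift_steps[OF F(1)] doubled_odd_writhe_diagram_equiv[OF F(2)]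
        assms D' by simp
  qed
qed

section \<open>Chains of virtual trefoils\<close>

lemma diagram_equiv_refl: "gauss_diagram w \<Longrightarrow> diagram_equiv w w"
  by (simp add: diagram_equiv_def)

lemma diagram_equiv_sym: "diagram_equiv v w \<Longrightarrow> diagram_equiv w v"
  by (simp add: diagram_equiv_def equivclp_sym)

lemma diagram_equiv_trans [trans]:
  "diagram_equiv u v \<Longrightarrow> diagram_equiv v w \<Longrightarrow> diagram_equiv u w"
  by (auto simp: diagram_equiv_def intro: equivclp_trans)

lemma diagram_equiv_move:
  "move v w \<Longrightarrow> gauss_diagram v \<Longrightarrow> gauss_diagram w \<Longrightarrow> diagram_equiv v w"
  by (simp add: diagram_equiv_def r_into_equivclp)

text \<open>
The virtual trefoil: one crossing of the standard trefoil diagram is made virtual, which leaves two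
crossing chords of the same sign, both odd.
\<close>

definition trefoil :: "nat \<Rightarrow> code" where
  "trefoil n = [Endpoint Over (2 * n) 1, Endpoint Over (2 * n + 1) 1,
                Endpoint Under (2 * n) 1, Endpoint Under (2 * n + 1) 1]"

text \<open>
The tail \<open>t\<close> will be empty or a single bar, which gives the two sequences at once.
\<close>

fun trefoil_chain :: "code \<Rightarrow> nat \<Rightarrow> code" where
  "trefoil_chain t 0 = t"
| "trefoil_chain t (Suc n) = trefoil n @ trefoil_chain t n"

lemma chords_trefoil [simp]: "chords (trefoil n) = {2 * n, 2 * n + 1}"
  by (auto simp: trefoil_def)

lemma chords_trefoil_chain: "chords t = {} \<Longrightarrow> chords (trefoil_chain t n) = {..<2 * n}"
  by (induction n) auto

lemma gauss_diagram_trefoil_chain: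
  assumes "chords t = {}"
  shows "gauss_diagram (trefoil_chain t n)"
proof (induction n)
  case 0
  then show ?case by (simp add: gauss_diagram_def assms)
next
  case (Suc n)
  have "gauss_diagram (trefoil n)"
    unfolding gauss_diagram_def chords_trefoil by (auto simp: trefoil_def)
  with Suc show ?case
    by (auto intro!: gauss_diagram_append simp: chords_trefoil_chain[OF assms])
qed

lemma doubled_odd_writhe_trefoil_chain:
  assumes "chords t = {}"
  shows "doubled_odd_writhe (trefoil_chain t n) = 4 * int n"
proof (induction n)
  case 0
  then show ?case by (simp add: doubled_odd_writhe_def assms)
next
  case (Suc n)
  let ?w = "trefoil_chain t n" and ?v = "trefoil n @ trefoil_chain t n"
  have "doubled_odd_writhe ?v = of_bool (odd_chord (2 * n) ?v) * sign_sum (2 * n) ?v +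
      of_bool (odd_chord (2 * n + 1) ?v) * sign_sum (2 * n + 1) ?v +
      (\<Sum>e\<in>chords ?w. of_bool (odd_chord e ?v) * sign_sum e ?v)"
    by (simp add: doubled_odd_writhe_def chords_trefoil_chain[OF assms])
  moreover have "(\<Sum>e\<in>chords ?w. of_bool (odd_chord e ?v) * sign_sum e ?v) =
      doubled_odd_writhe ?w"
    unfolding doubled_odd_writhe_def by (rule sum.cong)
      (auto simp: odd_chord_def trefoil_def chords_trefoil_chain[OF assms])
  moreover have "odd_chord e ?v \<and> sign_sum e ?v = 2" if "e = 2 * n \<or> e = 2 * n + 1" for e
    using that by (auto simp: odd_chord_def trefoil_def chords_trefoil_chain[OF assms])
  ultimately show ?case
    using Suc by simp
qed

text \<open>
Interchanging the two overcrossings of a trefoil block makes its chords parallel instead of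
crossing.  The inner chord is then a kink, and the outer one is a kink once the inner one is gone.
\<close>

lemma arc_shift_trefoil_chain:
  assumes "chords t = {}"
  obtains E where "arc_shift (trefoil_chain t (Suc n)) E" "diagram_equiv E (trefoil_chain t n)"
proof
  let ?w = "trefoil_chain t n"
  let ?a = "\<lambda>r. Endpoint r (2 * n) (-1 :: int)" and ?b = "\<lambda>r. Endpoint r (2 * n + 1) (-1 :: int)"
  let ?E = "[?b Over, ?a Over, ?a Under, ?b Under] @ ?w"
  have w: "gauss_diagram ?w" "chords ?w = {..<2 * n}"
    by (simp_all add: assms gauss_diagram_trefoil_chain chords_trefoil_chain)
  have "arc_shift ([Endpoint Over (2 * n) 1] @ replicate 0 Bar @ [Endpoint Over (2 * n + 1) 1] @
        [Endpoint Under (2 * n) 1, Endpoint Under (2 * n + 1) 1] @ ?w)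
      (change_signs {2 * n, 2 * n + 1} ([Endpoint Over (2 * n + 1) 1] @ replicate 0 Bar @
        [Endpoint Over (2 * n) 1] @ [Endpoint Under (2 * n) 1, Endpoint Under (2 * n + 1) 1] @ ?w))"
    by (rule arc_shift.intros) (auto simp: passage_def)
  moreover have "change_signs {2 * n, 2 * n + 1} ?w = ?w"
    by (rule change_signs_id) (auto simp: w)
  ultimately show "arc_shift (trefoil_chain t (Suc n)) ?E"
    by (simp add: trefoil_def change_signs_def)
  have kink: "gauss_diagram ([Endpoint Over c (-1), Endpoint Under c (-1)] @ v)"
    if "gauss_diagram v" "c \<notin> chords v" for c v
    by (rule gauss_diagram_append) (use that in \<open>auto simp: gauss_diagram_def\<close>)
  have b: "gauss_diagram ([?b Over, ?b Under] @ ?w)"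
    by (rule kink) (simp_all add: w)
  have b': "gauss_diagram ([?b Under] @ ?w @ [?b Over])"
    using b by (rule gauss_diagram_mset_cong[THEN iffD1, rotated]) simp
  have ab': "gauss_diagram ([?a Over, ?a Under] @ [?b Under] @ ?w @ [?b Over])"
    by (rule kink) (use b' in \<open>simp_all add: w\<close>)
  have ab: "gauss_diagram ?E"
    using ab' by (rule gauss_diagram_mset_cong[THEN iffD1, rotated]) simp
  \<comment> \<open>\<open>R1\<close> acts at the start of the code, so the base point is moved past \<open>?b Over\<close> and back.\<close>
  have "diagram_equiv ?E ([?a Over, ?a Under] @ [?b Under] @ ?w @ [?b Over])"
    using move.base_point[of "[?b Over]" "[?a Over, ?a Under, ?b Under] @ ?w"] ab ab'
    by (intro diagram_equiv_move) simp_all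
  also have "diagram_equiv \<dots> ([?b Under] @ ?w @ [?b Over])"
    using move.R1[of Over "2 * n" "-1" "[?b Under] @ ?w @ [?b Over]"] ab' b'
    by (intro diagram_equiv_move) simp_all
  also have "diagram_equiv \<dots> ([?b Over, ?b Under] @ ?w)"
    using move.base_point[of "[?b Under] @ ?w" "[?b Over]"] b b'
    by (intro diagram_equiv_move) simp_all
  also have "diagram_equiv \<dots> ?w"
    using move.R1[of Over "2 * n + 1" "-1" ?w] b w
    by (intro diagram_equiv_move) simp_all
  finally show "diagram_equiv ?E ?w" .
qed

lemma arc_shift_steps_trefoil_chain:
  assumes "chords t = {}"
  shows "(arc_shift_step ^^ n) (trefoil_chain t n) t"
proof (induction n)
  case (Suc n)
  obtain E where "arc_shift (trefoil_chain t (Suc n)) E" "diagram_equiv E (trefoil_chain t n)"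
    using arc_shift_trefoil_chain[OF assms] .
  then have "arc_shift_step (trefoil_chain t (Suc n)) (trefoil_chain t n)"
    using diagram_equiv_refl[OF gauss_diagram_trefoil_chain[OF assms, of "Suc n"]]
    unfolding arc_shift_step_def by blast
  then show ?case
    using Suc by (rule relpowp_Suc_I2)
qed simp

lemma arc_shift_number_trefoil_chain:
  assumes t: "t = [] \<or> t = [Bar]"
  shows "arc_shift_number (knot_of (trefoil_chain t n)) = enat n"
proof (rule antisym)
  have chords: "chords t = {}"
    using t by auto
  have gauss: "gauss_diagram (trefoil_chain t n)" "gauss_diagram t"
    using gauss_diagram_trefoil_chain[OF chords, of n] gauss_diagram_trefoil_chain[OF chords, of 0]
    by auto
  have "arc_shift_number (knot_of (trefoil_chain t n)) \<le> arc_shift_number_diagram (trefoil_chain t n)"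
    unfolding arc_shift_number_def
    by (rule INF_lower) (simp add: knot_of_def diagram_equiv_refl gauss)
  also have "\<dots> \<le> enat n"
    unfolding arc_shift_number_diagram_def
  proof (rule Inf_lower, rule CollectI, intro exI conjI)
    show "((arc_shift_step ^^ n) OO diagram_equiv) (trefoil_chain t n) t"
      using arc_shift_steps_trefoil_chain[OF chords, of n] diagram_equiv_refl[OF gauss(2)] by blast
    show "t \<in> trivial_knot \<union> trivial_knot_with_bar"
      using t gauss(2)
      by (auto simp: trivial_knot_def trivial_knot_with_bar_def knot_of_def diagram_equiv_refl)
  qed simp
  finally show "arc_shift_number (knot_of (trefoil_chain t n)) \<le> enat n" .
  show "enat n \<le> arc_shift_number (knot_of (trefoil_chain t n))"
    by (rule arc_shift_number_lower_bound) (simp add: doubled_odd_writhe_trefoil_chain chords)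
qed

lemma unknotting_sequence_trefoil_chain:
  assumes t: "t = [] \<or> t = [Bar]"
  shows "unknotting_sequence (map (\<lambda>n. knot_of (trefoil_chain t n)) (rev [0..<Suc m]))"
proof -
  let ?K = "\<lambda>n. knot_of (trefoil_chain t n)"
  have chords: "chords t = {}"
    using t by auto
  have step: "knot_arc_shift (?K (Suc n)) (?K n)" for n
  proof -
    obtain E where E: "arc_shift (trefoil_chain t (Suc n)) E" "diagram_equiv E (trefoil_chain t n)"
      using arc_shift_trefoil_chain[OF chords] .
    have "trefoil_chain t (Suc n) \<in> ?K (Suc n)" "E \<in> ?K n"
      using E diagram_equiv_refl[OF gauss_diagram_trefoil_chain[OF chords, of "Suc n"]]
      by (simp_all add: knot_of_def diagram_equiv_sym)
    with E(1) show ?thesis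
      unfolding knot_arc_shift_def by blast
  qed
  have "successively knot_arc_shift (map ?K (rev [0..<Suc m]))"
  proof (induction m)
    case (Suc m)
    then show ?case
      using step[of m] by simp
  qed simp
  moreover have "last (map ?K (rev [0..<Suc m])) = ?K 0"
    by (simp add: last_map last_rev del: upt_Suc)
  moreover have "set (map ?K (rev [0..<Suc m])) \<subseteq> twisted_knots"
    using gauss_diagram_trefoil_chain[OF chords] by (auto simp: twisted_knots_def)
  ultimately show ?thesis
    using t by (auto simp: unknotting_sequence_def trivial_knot_def trivial_knot_with_bar_def)
qed

lemma trivial_knots_distinct: "trivial_knot \<noteq> trivial_knot_with_bar"
proof
  assume "trivial_knot = trivial_knot_with_bar"
  moreover have "[Bar] \<in> trivial_knot_with_bar"
    by (auto simp: trivial_knot_with_bar_def knot_of_def gauss_diagram_def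
        intro!: diagram_equiv_refl)
  ultimately have "[Bar] \<in> trivial_knot"
    by (simp only:)
  then have "diagram_equiv [] [Bar]"
    by (simp add: trivial_knot_def knot_of_def)
  then have "even (count_list ([] :: code) Bar) \<longleftrightarrow> even (count_list ([Bar] :: code) Bar)"
    by (rule diagram_equiv_invariant) (rule even_bars_move)
  then show False
    by simp
qed

theorem theorem3p3:
  fixes m :: nat
  assumes "m \<ge> 1"
  shows "\<exists>K K' :: nat \<Rightarrow> knot.
    unknotting_sequence (map K (rev [0..<Suc m])) \<and>
    unknotting_sequence (map K' (rev [0..<Suc m])) \<and>
    map K (rev [0..<Suc m]) \<noteq> map K' (rev [0..<Suc m]) \<and>
    K 0 = trivial_knot \<and> K' 0 = trivial_knot_with_bar \<and>
    (\<forall>n. 1 \<le> n \<and> n \<le> m \<longrightarrow> arc_shift_number (K n) = enat n \<and> arc_shift_number (K' n) = enat n)"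
proof -
  let ?K = "\<lambda>t n. knot_of (trefoil_chain t n)"
  have "map (?K []) (rev [0..<Suc m]) \<noteq> map (?K [Bar]) (rev [0..<Suc m])"
  proof
    assume "map (?K []) (rev [0..<Suc m]) = map (?K [Bar]) (rev [0..<Suc m])"
    from arg_cong[OF this, of last] have "?K [] 0 = ?K [Bar] 0"
      by (simp add: last_map last_rev del: upt_Suc)
    with trivial_knots_distinct show False
      by (simp add: trivial_knot_def trivial_knot_with_bar_def)
  qed
  then show ?thesis
    by (intro exI[of _ "?K []"] exI[of _ "?K [Bar]"])
      (simp add: unknotting_sequence_trefoil_chain arc_shift_number_trefoil_chain
        trivial_knot_def trivial_knot_with_bar_def del: upt_Suc)
qed

end
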